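(* (1) If $[\omega]^\omega$ contains a strictly $\subset^*$-descending $\omega_2$-sequence, then there exists an $A$-filter on $\omega$ which has no countable base. (2) If $2^\omega=\omega_1$, then any $A$-filter on $\omega$ has a countable base.
   Context: $[\omega]^\omega$ is the set of all infinite subsets of $\omega$; for $A,B\in[\omega]^\omega$, $A\subset^*B$ means that $A\setminus B$ is finite. For a cardinal $\kappa$, a family $\{B_\alpha:\alpha<\kappa\}\subset[\omega]^\omega$ is a $\subset^*$-descending $\kappa$-sequence if $B_\beta\subset^*B_\alpha$ whenever $\alpha<\beta<\kappa$; it is a strictly $\subset^*$-descending $\kappa$-sequence if, in addition, $B_\alpha\setminus B_\beta$ is infinite whenever $\alpha<\beta<\kappa$. A filter $\mathscr F$ on a set is an $A$-filter if, given any $F_\alpha\in\mathscr F$, $\alpha<\omega_1$, there exist $G_n\in\mathscr F$, $n<\omega$, such that each $F_\alpha$ contains $G_{n_\alpha}$ for some $n_\alpha<\omega$. A base of $\mathscr F$ is a subfamily $\mathscr B\subset\mathscr F$ such that every element of $\mathscr F$ contains an element of $\mathscr B$. *)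

theory Defs
  imports "HOL-Library.Countable_Set"
begin

unbundle cardinal_syntax

(* A cardinal kappa is represented, as in the library, by a Card_order relation r (an initial
   ordinal): its ordinals are the elements of Field r, and alpha < beta reads
   "alpha \<in> underS r beta".  The relations below are well-orders of type omega_1 and omega_2. *)

abbreviation omega1 :: "nat set rel" where
  "omega1 \<equiv> cardSuc natLeq"

abbreviation omega2 :: "nat set set rel" where
  "omega2 \<equiv> cardSuc omega1"

definition infinite_sets :: "nat set set" where
  "infinite_sets = {A. infinite A}"

definition almost_subset :: "nat set \<Rightarrow> nat set \<Rightarrow> bool" (infix "\<subseteq>*" 50) where
  "A \<subseteq>* B \<longleftrightarrow> finite (A - B)"

definition descending_seq :: "'i rel \<Rightarrow> ('i \<Rightarrow> nat set) \<Rightarrow> bool" where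
  "descending_seq \<kappa> B \<longleftrightarrow>
     (\<forall>\<alpha>\<in>Field \<kappa>. B \<alpha> \<in> infinite_sets) \<and>
     (\<forall>\<beta>\<in>Field \<kappa>. \<forall>\<alpha>\<in>underS \<kappa> \<beta>. B \<beta> \<subseteq>* B \<alpha>)"

definition strictly_descending_seq :: "'i rel \<Rightarrow> ('i \<Rightarrow> nat set) \<Rightarrow> bool" where
  "strictly_descending_seq \<kappa> B \<longleftrightarrow>
     descending_seq \<kappa> B \<and>
     (\<forall>\<beta>\<in>Field \<kappa>. \<forall>\<alpha>\<in>underS \<kappa> \<beta>. infinite (B \<alpha> - B \<beta>))"

definition filter_sets :: "'a filter \<Rightarrow> 'a set set" where
  "filter_sets F = {A. eventually (\<lambda>x. x \<in> A) F}"

(* Filters are proper by convention, whereas the library type also contains the improper filter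
   bot; hence the first conjunct.  (The improper filter has the countable base {{}}.) *)
definition A_filter :: "'a filter \<Rightarrow> bool" where
  "A_filter \<F> \<longleftrightarrow>
     \<F> \<noteq> bot \<and>
     (\<forall>F. (\<forall>\<alpha>\<in>Field omega1. F \<alpha> \<in> filter_sets \<F>) \<longrightarrow>
        (\<exists>G :: nat \<Rightarrow> 'a set. (\<forall>n. G n \<in> filter_sets \<F>) \<and>
           (\<forall>\<alpha>\<in>Field omega1. \<exists>n. G n \<subseteq> F \<alpha>)))"

definition filter_base :: "'a filter \<Rightarrow> 'a set set \<Rightarrow> bool" where
  "filter_base \<F> \<B> \<longleftrightarrow>
     \<B> \<subseteq> filter_sets \<F> \<and> (\<forall>A\<in>filter_sets \<F>. \<exists>B\<in>\<B>. B \<subseteq> A)"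

definition has_countable_base :: "'a filter \<Rightarrow> bool" where
  "has_countable_base \<F> \<longleftrightarrow> (\<exists>\<B>. countable \<B> \<and> filter_base \<F> \<B>)"

end

theory Submission
  imports Defs
begin

text \<open>
  For the first part, generate a filter by all sets \<open>B \<alpha> - E\<close> with \<open>E\<close> finite.  A set belongs to it
  iff it almost contains some \<open>B \<alpha>\<close>, and the sets almost containing \<open>B \<alpha>\<close> grow with \<open>\<alpha>\<close>.  Since
  \<open>\<omega>\<^sub>2\<close> is regular, any \<open>\<omega>\<^sub>1\<close> members of the filter are therefore caught at a single index: they
  all almost contain the same \<open>B \<alpha>\<close> (\<open>few_members_share_pseudointersection\<close>).  This bounding
  property gives both conclusions.  The countably many sets \<open>B \<alpha> - {..<n}\<close> witness the
  \<open>A\<close>-filter property for the given \<open>\<omega>\<^sub>1\<close> members.  A countable base would likewise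
  consist of sets almost containing one \<open>B \<alpha>\<close>; then so would every member of the filter, among
  them \<open>B \<beta>\<close> for \<open>\<beta> > \<alpha>\<close>, contrary to strictness.

  For the second part, the continuum hypothesis allows all members of the filter to be listed in
  type \<open>\<omega>\<^sub>1\<close>.  The sets \<open>G n\<close> that the \<open>A\<close>-filter property provides for this list form a base.
\<close>

lemma almost_subset_trans: "A \<subseteq>* B \<Longrightarrow> B \<subseteq>* C \<Longrightarrow> A \<subseteq>* C"
  unfolding almost_subset_def
  by (rule finite_subset[of _ "(A - B) \<union> (B - C)"]) auto

lemma subset_imp_almost_subset: "A \<subseteq> B \<Longrightarrow> A \<subseteq>* B"
  by (simp add: almost_subset_def Diff_eq_empty_iff[THEN iffD2])

lemma descending_seq_le:
  assumes "descending_seq \<kappa> B" "(\<alpha>, \<beta>) \<in> \<kappa>"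
  shows "B \<beta> \<subseteq>* B \<alpha>"
proof (cases "\<alpha> = \<beta>")
  case True
  then show ?thesis by (simp add: subset_imp_almost_subset)
next
  case False
  then have "\<alpha> \<in> underS \<kappa> \<beta>" "\<beta> \<in> Field \<kappa>"
    using assms(2) by (auto simp: underS_def Field_def)
  then show ?thesis using assms(1) unfolding descending_seq_def by blast
qed

text \<open>
  The filter \<open>inf cofinite (principal X)\<close> consists of the sets that almost contain \<open>X\<close>.
\<close>

definition tower_filter :: "'i rel \<Rightarrow> ('i \<Rightarrow> nat set) \<Rightarrow> nat filter" where
  "tower_filter \<kappa> B = (INF \<alpha>\<in>Field \<kappa>. inf cofinite (principal (B \<alpha>)))"

text \<open>
  Of two members of a descending sequence, the later one is almost contained in the other.  The
  defining infimum is therefore directed, and membership is decided by a single index.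
\<close>

lemma tower_filter_iff:
  assumes "Card_order \<kappa>" "Field \<kappa> \<noteq> {}" "descending_seq \<kappa> B"
  shows "A \<in> filter_sets (tower_filter \<kappa> B) \<longleftrightarrow> (\<exists>\<alpha>\<in>Field \<kappa>. B \<alpha> \<subseteq>* A)"
proof -
  have sub: "eventually P (inf cofinite (principal X)) \<longleftrightarrow> X \<subseteq>* Collect P"
    for P and X :: "nat set"
    by (simp add: eventually_inf_principal eventually_cofinite almost_subset_def set_diff_eq)
  have mono: "inf cofinite (principal X) \<le> inf cofinite (principal Y)"
    if "X \<subseteq>* Y" for X Y :: "nat set"
    using almost_subset_trans[OF that] by (auto simp: le_filter_def sub)
  have directed: "\<exists>\<gamma>\<in>Field \<kappa>. inf cofinite (principal (B \<gamma>))
      \<le> inf (inf cofinite (principal (B \<alpha>))) (inf cofinite (principal (B \<beta>)))"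
    if in_Field: "\<alpha> \<in> Field \<kappa>" "\<beta> \<in> Field \<kappa>" for \<alpha> \<beta>
  proof -
    have wo: "Well_order \<kappa>" using assms(1) unfolding card_order_on_def by blast
    have refl: "(\<gamma>, \<gamma>) \<in> \<kappa>" if "\<gamma> \<in> Field \<kappa>" for \<gamma>
      using wo that by (auto simp: order_on_defs refl_on_def)
    have "(\<alpha>, \<beta>) \<in> \<kappa> \<or> (\<beta>, \<alpha>) \<in> \<kappa>"
      using wo in_Field refl by (cases "\<alpha> = \<beta>") (auto simp: order_on_defs total_on_def)
    then obtain \<gamma> where "\<gamma> \<in> Field \<kappa>" "(\<alpha>, \<gamma>) \<in> \<kappa>" "(\<beta>, \<gamma>) \<in> \<kappa>"
      using in_Field refl by blast
    then show ?thesis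
      by (meson assms(3) descending_seq_le inf.boundedI mono)
  qed
  show ?thesis
    unfolding filter_sets_def tower_filter_def
    using assms(2) directed by (simp add: eventually_INF_base sub)
qed

lemma tower_filter_proper:
  assumes "Card_order \<kappa>" "Field \<kappa> \<noteq> {}" "descending_seq \<kappa> B"
  shows "tower_filter \<kappa> B \<noteq> bot"
proof
  assume "tower_filter \<kappa> B = bot"
  then have "{} \<in> filter_sets (tower_filter \<kappa> B)" by (simp add: filter_sets_def)
  then obtain \<alpha> where "\<alpha> \<in> Field \<kappa>" "B \<alpha> \<subseteq>* {}"
    unfolding tower_filter_iff[OF assms] by blast
  then show False
    using assms(3) by (auto simp: descending_seq_def infinite_sets_def almost_subset_def)
qed

text \<open>
  The families of sets that almost contain \<open>B \<alpha>\<close> form an increasing chain along the successor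
  cardinal of \<open>r\<close>, with the filter as union. By regularity of that cardinal, \<open>r\<close> many
  members of the union already lie in one family of the chain.
\<close>

lemma few_members_share_pseudointersection:
  assumes r: "Cinfinite r" and B: "descending_seq (cardSuc r) B"
    and S: "S \<subseteq> filter_sets (tower_filter (cardSuc r) B)" "|S| \<le>o r"
  obtains \<alpha> where "\<alpha> \<in> Field (cardSuc r)" "\<And>A. A \<in> S \<Longrightarrow> B \<alpha> \<subseteq>* A"
proof -
  have iff: "A \<in> filter_sets (tower_filter (cardSuc r) B)
      \<longleftrightarrow> (\<exists>\<alpha>\<in>Field (cardSuc r). B \<alpha> \<subseteq>* A)" for A
    using r B by (intro tower_filter_iff) (auto simp: cardSuc_Card_order Field_cardSuc_not_empty)
  have "relChain (cardSuc r) (\<lambda>\<alpha>. {A. B \<alpha> \<subseteq>* A})"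
    unfolding relChain_def using almost_subset_trans descending_seq_le[OF B] by blast
  moreover have "S \<subseteq> (\<Union>\<alpha>\<in>Field (cardSuc r). {A. B \<alpha> \<subseteq>* A})"
    using S(1) iff by blast
  ultimately show ?thesis
    using cardSuc_UNION_Cinfinite[OF r _ _ S(2)] that by blast
qed

lemma Cinfinite_omega1: "Cinfinite omega1"
  by (rule Cinfinite_cardSuc[OF natLeq_Cinfinite])

lemma A_filter_tower_filter:
  assumes "descending_seq omega2 B"
  shows "A_filter (tower_filter omega2 B)"
  unfolding A_filter_def
proof (intro conjI allI impI)
  have \<kappa>: "Card_order omega2" "Field omega2 \<noteq> {}"
    using Cinfinite_omega1 by (auto simp: cardSuc_Card_order Field_cardSuc_not_empty)
  note iff = tower_filter_iff[OF \<kappa> assms]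
  show "tower_filter omega2 B \<noteq> bot" by (rule tower_filter_proper[OF \<kappa> assms])
  fix F assume F: "\<forall>\<xi>\<in>Field omega1. F \<xi> \<in> filter_sets (tower_filter omega2 B)"
  have "|F ` Field omega1| \<le>o omega1"
    by (rule ordLeq_ordIso_trans[OF card_of_image card_of_Field_ordIso])
      (rule cardSuc_Card_order[OF natLeq_Card_order])
  then obtain \<alpha> where \<alpha>: "\<alpha> \<in> Field omega2" "\<And>\<xi>. \<xi> \<in> Field omega1 \<Longrightarrow> B \<alpha> \<subseteq>* F \<xi>"
    using few_members_share_pseudointersection[OF Cinfinite_omega1 assms, of "F ` Field omega1"] F
    by (metis image_eqI image_subsetI)
  have "B \<alpha> - {..<n} \<in> filter_sets (tower_filter omega2 B)" for n
    unfolding iff using \<alpha>(1)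
    by (intro bexI[of _ \<alpha>]) (auto simp: almost_subset_def intro: finite_subset[of _ "{..<n}"])
  moreover have "\<exists>n. B \<alpha> - {..<n} \<subseteq> F \<xi>" if \<xi>: "\<xi> \<in> Field omega1" for \<xi>
  proof -
    obtain n where "B \<alpha> - F \<xi> \<subseteq> {..<n}"
      using \<alpha>(2)[OF \<xi>] unfolding almost_subset_def by (auto simp: finite_nat_iff_bounded)
    then have "B \<alpha> - {..<n} \<subseteq> F \<xi>" by blast
    then show ?thesis by blast
  qed
  ultimately show "\<exists>G :: nat \<Rightarrow> nat set. (\<forall>n. G n \<in> filter_sets (tower_filter omega2 B)) \<and>
      (\<forall>\<xi>\<in>Field omega1. \<exists>n. G n \<subseteq> F \<xi>)"
    by (intro exI[of _ "\<lambda>n. B \<alpha> - {..<n}"]) blast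
qed

text \<open>
  The same bounding argument rules out any base of size at most \<open>r\<close>, since a successor cardinal
  has an index beyond the one that bounds the base.
\<close>

lemma strict_tower_filter_no_small_base:
  assumes r: "Cinfinite r" and B: "strictly_descending_seq (cardSuc r) B"
    and base: "filter_base (tower_filter (cardSuc r) B) \<B>"
  shows "\<not> |\<B>| \<le>o r"
proof
  assume "|\<B>| \<le>o r"
  have desc: "descending_seq (cardSuc r) B"
    using B unfolding strictly_descending_seq_def by blast
  obtain \<alpha> where \<alpha>: "\<alpha> \<in> Field (cardSuc r)" "\<And>A. A \<in> \<B> \<Longrightarrow> B \<alpha> \<subseteq>* A"
    using few_members_share_pseudointersection[OF r desc _ \<open>|\<B>| \<le>o r\<close>] base
    unfolding filter_base_def by blast
  have \<kappa>: "Cinfinite (cardSuc r)" using r by (rule Cinfinite_cardSuc)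
  then obtain \<beta> where \<beta>: "\<beta> \<in> Field (cardSuc r)" "\<alpha> \<in> underS (cardSuc r) \<beta>"
    using infinite_Card_order_limit[of "cardSuc r" \<alpha>] \<alpha>(1)
    unfolding cinfinite_def underS_def by blast
  have "B \<beta> \<in> filter_sets (tower_filter (cardSuc r) B)"
    using tower_filter_iff[OF _ _ desc] \<kappa> \<beta>(1) subset_imp_almost_subset[of "B \<beta>" "B \<beta>"] by blast
  then obtain A where "A \<in> \<B>" "A \<subseteq> B \<beta>"
    using base unfolding filter_base_def by blast
  then have "B \<alpha> \<subseteq>* B \<beta>"
    using \<alpha>(2) almost_subset_trans subset_imp_almost_subset by blast
  then show False
    using B \<beta> unfolding strictly_descending_seq_def almost_subset_def by blast
qed

lemma A_filter_few_members_imp_countable_base: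
  assumes "A_filter \<F>" "|filter_sets \<F>| \<le>o omega1"
  shows "has_countable_base \<F>"
proof -
  have le: "|filter_sets \<F>| \<le>o |Field omega1|"
    by (rule ordLeq_ordIso_trans[OF assms(2) ordIso_symmetric[OF card_of_Field_ordIso]])
      (rule cardSuc_Card_order[OF natLeq_Card_order])
  have "UNIV \<in> filter_sets \<F>" by (simp add: filter_sets_def)
  then have "filter_sets \<F> \<noteq> {}" by blast
  from iffD2[OF card_of_ordLeq2[OF this] le]
  obtain F where F: "F ` Field omega1 = filter_sets \<F>" ..
  then have "\<forall>\<alpha>\<in>Field omega1. F \<alpha> \<in> filter_sets \<F>" by blast
  then obtain G :: "nat \<Rightarrow> 'a set" where
    G: "\<forall>n. G n \<in> filter_sets \<F>" "\<forall>\<alpha>\<in>Field omega1. \<exists>n. G n \<subseteq> F \<alpha>"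
    using assms(1) unfolding A_filter_def by blast
  have "\<exists>C\<in>range G. C \<subseteq> A" if "A \<in> filter_sets \<F>" for A
  proof -
    obtain \<alpha> where \<alpha>: "\<alpha> \<in> Field omega1" "A = F \<alpha>"
      using \<open>A \<in> filter_sets \<F>\<close> unfolding F[symmetric] by (rule imageE)
    from bspec[OF G(2) \<alpha>(1)] obtain n where "G n \<subseteq> F \<alpha>" ..
    then show ?thesis unfolding \<alpha>(2) by (rule rev_bexI[OF rangeI])
  qed
  then have "filter_base \<F> (range G)"
    unfolding filter_base_def using G(1) by blast
  then show ?thesis
    unfolding has_countable_base_def by (intro exI[of _ "range G"]) simp
qed

lemma card_nat_sets_continuum: "|S :: nat set set| \<le>o ctwo ^c natLeq"
proof -
  have "|S| \<le>o |Pow (UNIV :: nat set)|" by (rule card_of_mono1) simp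
  also have "|Pow (UNIV :: nat set)| =o ctwo ^c natLeq"
    using card_of_Pow_Func[of "UNIV :: nat set"]
    by (simp add: cexp_def ctwo_def Field_card_of Field_natLeq)
  finally show ?thesis .
qed

theorem theorem4p1:
  shows "((\<exists>B. strictly_descending_seq omega2 B) \<longrightarrow>
            (\<exists>\<F> :: nat filter. A_filter \<F> \<and> \<not> has_countable_base \<F>)) \<and>
         (ctwo ^c natLeq =o omega1 \<longrightarrow>
            (\<forall>\<F> :: nat filter. A_filter \<F> \<longrightarrow> has_countable_base \<F>))"
proof (intro conjI impI allI)
  assume "\<exists>B. strictly_descending_seq omega2 B"
  then obtain B where B: "strictly_descending_seq omega2 B" by blast
  then have desc: "descending_seq omega2 B"
    unfolding strictly_descending_seq_def by blast
  have small: "|\<B>| \<le>o omega1" if "countable \<B>" for \<B> :: "nat set set"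
  proof -
    have "|\<B>| \<le>o |UNIV :: nat set|"
      using that unfolding countable_def by (auto simp: card_of_ordLeq[symmetric])
    also have "|UNIV :: nat set| =o natLeq" by (rule card_of_nat)
    also have "natLeq \<le>o omega1" by (rule cardSuc_ordLeq[OF natLeq_Card_order])
    finally show ?thesis .
  qed
  have "\<not> has_countable_base (tower_filter omega2 B)"
    using strict_tower_filter_no_small_base[OF Cinfinite_omega1 B] small
    unfolding has_countable_base_def by blast
  then show "\<exists>\<F> :: nat filter. A_filter \<F> \<and> \<not> has_countable_base \<F>"
    using A_filter_tower_filter[OF desc] by blast
next
  fix \<F> :: "nat filter"
  assume CH: "ctwo ^c natLeq =o omega1" and "A_filter \<F>"
  then show "has_countable_base \<F>"
    using A_filter_few_members_imp_countable_base
      ordLeq_ordIso_trans[OF card_nat_sets_continuum CH] by blast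
qed

end
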